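(* Let $(K,I,J,g,q)$ be a finite two-player zero-sum stochastic game with $K=\{1,\dots,n\}$, and let $k\in K$ be an initial state. For any $\lambda\in(0,1]$, the value $v^k_\lambda$ of the discounted stochastic game $(K,I,J,g,q,k,\lambda)$ is the unique solution to $$z\in\mathbb{R},\qquad \mathrm{val}\, W^k_\lambda(z)=0,$$ where $W^k_\lambda(z)$ is the $|I|^n\times|J|^n$ real matrix with entries $W^k_\lambda(z)[\mathbf{i},\mathbf{j}]=d^k_\lambda(\mathbf{i},\mathbf{j})-z\,d^0_\lambda(\mathbf{i},\mathbf{j})$ for $(\mathbf{i},\mathbf{j})\in I^n\times J^n$.
   Context: For a finite set $E$, $\Delta(E)$ is the set of probability distributions on $E$. The value $\mathrm{val}\,M$ of a real $p\times q$ matrix $M=(m_{a,b})$ is the minmax value $\max_{s}\min_{t}\sum_{a,b}s(a)m_{a,b}t(b)=\min_t\max_s\sum_{a,b}s(a)m_{a,b}t(b)$, with $s\in\Delta(\{1,\dots,p\})$, $t\in\Delta(\{1,\dots,q\})$. Stochastic game $(K,I,J,g,q,k)$: $K=\{1,\dots,n\}$ is a finite set of states ($n\geq1$), $I,J$ are finite nonempty action sets of Players 1 and 2, $g:K\times I\times J\to\mathbb{R}$ is the reward function (to Player 1), $q:K\times I\times J\to\Delta(K)$ is the transition function (write $q(\ell'\mid\ell,i,j)$ for the probability of moving to $\ell'$), and $k\in K$ is the initial state. Play: $k_1=k$; at each stage $m\ge1$, knowing the current state $k_m$ and the past states and actions, the players independently and simultaneously choose $i_m\in I$ and $j_m\in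 J$; these are observed, and $k_{m+1}$ is drawn from $q(k_m,i_m,j_m)$. A strategy of Player 1 is a sequence $\sigma=(\sigma_m)_{m\ge1}$ of maps $\sigma_m:(K\times I\times J)^{m-1}\times K\to\Delta(I)$; a strategy of Player 2 is a sequence $\tau=(\tau_m)_{m\ge 1}$ of maps $\tau_m:(K\times I\times J)^{m-1}\times K\to\Delta(J)$. The sets of strategies are $\Sigma$ and $\mathcal{T}$. A pair $(\sigma,\tau)$ and $k$ induce a probability on plays $(K\times I\times J)^{\mathbb{N}}$, with expectation $\mathbb{E}^k_{\sigma,\tau}$. For $\lambda\in(0,1]$, the discounted game $(K,I,J,g,q,k,\lambda)$ has payoff $\gamma^k_\lambda(\sigma,\tau)=\mathbb{E}^k_{\sigma,\tau}\big[\sum_{m\ge1}\lambda(1-\lambda)^{m-1}g(k_m,i_m,j_m)\big]$, which Player 1 maximizes and Player 2 minimizes. Its value is $v^k_\lambda=\sup_{\sigma\in\Sigma}\inf_{\tau\in\mathcal{T}}\gamma^k_\lambda(\sigma,\tau)=\inf_{\tau\in\mathcal{T}}\sup_{\sigma\in\Sigma}\gamma^k_\lambda(\sigma,\tau)$ (it exists, by a theorem of Shapley). Elements $\mathbf{i}=(\mathbf{i}^1,\dots,\mathbf{i}^n)\in I^n$ and $\mathbf{j}=(\mathbf{j}^1,\dots,\mathbf{j}^n)\in J^n$ are pure stationary strategies (play $\mathbf{i}^\ell$, resp. $\mathbf{j}^\ell$, in state $\ell$). Let $Q(\mathbf{i},\mathbf{j})\in\mathbb{R}^{n\times n}$ have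 entries $Q^{\ell,\ell'}(\mathbf{i},\mathbf{j})=q(\ell'\mid\ell,\mathbf{i}^\ell,\mathbf{j}^\ell)$ and let $g(\mathbf{i},\mathbf{j})\in\mathbb{R}^n$ have entries $g^\ell(\mathbf{i},\mathbf{j})=g(\ell,\mathbf{i}^\ell,\mathbf{j}^\ell)$. Define $d^0_\lambda(\mathbf{i},\mathbf{j})=\det(\mathrm{Id}-(1-\lambda)Q(\mathbf{i},\mathbf{j}))$, and let $d^k_\lambda(\mathbf{i},\mathbf{j})$ be the determinant of the $n\times n$ matrix obtained by replacing the $k$-th column of $\mathrm{Id}-(1-\lambda)Q(\mathbf{i},\mathbf{j})$ with $\lambda g(\mathbf{i},\mathbf{j})$. *)

theory Defs
  imports "HOL-Analysis.Analysis" "HOL-Probability.Probability"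
begin

text \<open>
  Row player maximizes. By compactness the supremum and infimum are attained, and by the
  minimax theorem the order of the two can be exchanged.
\<close>

definition matrix_val :: "real ^ 'b::finite ^ 'a::finite \<Rightarrow> real" where
  "matrix_val M =
     (SUP s::'a pmf. INF t::'b pmf. \<Sum>a\<in>UNIV. \<Sum>b\<in>UNIV. pmf s a * M $ a $ b * pmf t b)"

text \<open>
  The set of states is an arbitrary finite (hence nonempty) type \<open>'k\<close>, and the finite
  action sets are types \<open>'i\<close> and \<open>'j\<close>. Stages are numbered from 0. A strategy takes the
  list of past (state, action, action) triples, oldest first, and the current state; the
  length of the list is the stage, so one function encodes the sequence of its stage maps.
\<close>

type_synonym ('k, 'i, 'j, 'a) strategy = "('k \<times> 'i \<times> 'j) list \<Rightarrow> 'k \<Rightarrow> 'a pmf"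

definition state_law ::
  "('k \<Rightarrow> 'i \<Rightarrow> 'j \<Rightarrow> 'k pmf) \<Rightarrow> 'k \<Rightarrow> ('k \<times> 'i \<times> 'j) list \<Rightarrow> 'k pmf" where
  "state_law q k h = (if h = [] then return_pmf k else (case last h of (l, a, b) \<Rightarrow> q l a b))"

definition stage_law ::
  "('k \<Rightarrow> 'i \<Rightarrow> 'j \<Rightarrow> 'k pmf) \<Rightarrow> 'k \<Rightarrow> ('k, 'i, 'j, 'i) strategy \<Rightarrow> ('k, 'i, 'j, 'j) strategy
    \<Rightarrow> ('k \<times> 'i \<times> 'j) list \<Rightarrow> ('k \<times> 'i \<times> 'j) pmf" where
  "stage_law q k \<sigma> \<tau> h =
     bind_pmf (state_law q k h) (\<lambda>l. map_pmf (Pair l) (pair_pmf (\<sigma> h l) (\<tau> h l)))"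

definition stage_kernel ::
  "('k \<Rightarrow> 'i \<Rightarrow> 'j \<Rightarrow> 'k pmf) \<Rightarrow> 'k \<Rightarrow> ('k, 'i, 'j, 'i) strategy \<Rightarrow> ('k, 'i, 'j, 'j) strategy
    \<Rightarrow> nat \<Rightarrow> (nat \<Rightarrow> 'k \<times> 'i \<times> 'j) \<Rightarrow> ('k \<times> 'i \<times> 'j) measure" where
  "stage_kernel q k \<sigma> \<tau> m \<omega> = measure_pmf (stage_law q k \<sigma> \<tau> (map \<omega> [0..<m]))"

text \<open>
  The law of the infinite play is the Ionescu-Tulcea limit of these kernels. The constants
  live in locales, and the lemmas below discharge the locale assumptions.
\<close>

definition play_measure ::
  "('k \<Rightarrow> 'i \<Rightarrow> 'j \<Rightarrow> 'k pmf) \<Rightarrow> 'k \<Rightarrow> ('k, 'i, 'j, 'i) strategy \<Rightarrow> ('k, 'i, 'j, 'j) strategy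
    \<Rightarrow> (nat \<Rightarrow> 'k \<times> 'i \<times> 'j) measure" where
  "play_measure q k \<sigma> \<tau> =
     projective_family.lim UNIV
       (Ionescu_Tulcea.CI (stage_kernel q k \<sigma> \<tau>) (\<lambda>_. count_space UNIV))
       (\<lambda>_. count_space UNIV)"

text \<open>Since stages start at 0, the weight of stage \<open>m\<close> is \<open>\<lambda>(1 - \<lambda>)\<^sup>m\<close>.\<close>

definition discounted_reward ::
  "('k \<Rightarrow> 'i \<Rightarrow> 'j \<Rightarrow> real) \<Rightarrow> real \<Rightarrow> (nat \<Rightarrow> 'k \<times> 'i \<times> 'j) \<Rightarrow> real" where
  "discounted_reward g lam \<omega> =
     (\<Sum>m. lam * (1 - lam) ^ m * (case \<omega> m of (l, a, b) \<Rightarrow> g l a b))"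

definition payoff ::
  "('k \<Rightarrow> 'i \<Rightarrow> 'j \<Rightarrow> real) \<Rightarrow> ('k \<Rightarrow> 'i \<Rightarrow> 'j \<Rightarrow> 'k pmf) \<Rightarrow> real \<Rightarrow> 'k
    \<Rightarrow> ('k, 'i, 'j, 'i) strategy \<Rightarrow> ('k, 'i, 'j, 'j) strategy \<Rightarrow> real" where
  "payoff g q lam k \<sigma> \<tau> = (\<integral>\<omega>. discounted_reward g lam \<omega> \<partial>play_measure q k \<sigma> \<tau>)"

text \<open>
  Payoffs are bounded by \<open>discounted_reward_bound\<close> below, so these are genuine suprema and
  infima in the reals. By Shapley's theorem the order of the two can be exchanged.
\<close>

definition discounted_val ::
  "('k::finite \<Rightarrow> 'i::finite \<Rightarrow> 'j::finite \<Rightarrow> real) \<Rightarrow> ('k \<Rightarrow> 'i \<Rightarrow> 'j \<Rightarrow> 'k pmf)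
    \<Rightarrow> real \<Rightarrow> 'k \<Rightarrow> real" where
  "discounted_val g q lam k =
     (SUP \<sigma>::('k, 'i, 'j, 'i) strategy. INF \<tau>::('k, 'i, 'j, 'j) strategy. payoff g q lam k \<sigma> \<tau>)"

text \<open>
  Pure stationary strategies are functions \<open>'k \<Rightarrow> 'i\<close> and \<open>'k \<Rightarrow> 'j\<close>. There are
  \<open>CARD('i) ^ CARD('k)\<close> and \<open>CARD('j) ^ CARD('k)\<close> of them, and they serve as the index
  types of the rows and columns of \<open>W_matrix\<close>.
\<close>

definition trans_matrix ::
  "('k::finite \<Rightarrow> 'i \<Rightarrow> 'j \<Rightarrow> 'k pmf) \<Rightarrow> ('k \<Rightarrow> 'i) \<Rightarrow> ('k \<Rightarrow> 'j) \<Rightarrow> real ^ 'k ^ 'k" where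
  "trans_matrix q ii jj = (\<chi> l l'. pmf (q l (ii l) (jj l)) l')"

definition reward_vec ::
  "('k::finite \<Rightarrow> 'i \<Rightarrow> 'j \<Rightarrow> real) \<Rightarrow> ('k \<Rightarrow> 'i) \<Rightarrow> ('k \<Rightarrow> 'j) \<Rightarrow> real ^ 'k" where
  "reward_vec g ii jj = (\<chi> l. g l (ii l) (jj l))"

definition d0 ::
  "('k::finite \<Rightarrow> 'i \<Rightarrow> 'j \<Rightarrow> 'k pmf) \<Rightarrow> real \<Rightarrow> ('k \<Rightarrow> 'i) \<Rightarrow> ('k \<Rightarrow> 'j) \<Rightarrow> real" where
  "d0 q lam ii jj = det (mat 1 - (1 - lam) *\<^sub>R trans_matrix q ii jj)"

definition dk ::
  "('k::finite \<Rightarrow> 'i \<Rightarrow> 'j \<Rightarrow> real) \<Rightarrow> ('k \<Rightarrow> 'i \<Rightarrow> 'j \<Rightarrow> 'k pmf) \<Rightarrow> real \<Rightarrow> 'k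
    \<Rightarrow> ('k \<Rightarrow> 'i) \<Rightarrow> ('k \<Rightarrow> 'j) \<Rightarrow> real" where
  "dk g q lam k ii jj =
     det (\<chi> l l'. if l' = k then (lam *\<^sub>R reward_vec g ii jj) $ l
                  else (mat 1 - (1 - lam) *\<^sub>R trans_matrix q ii jj) $ l $ l')"

definition W_matrix ::
  "('k::finite \<Rightarrow> 'i::finite \<Rightarrow> 'j::finite \<Rightarrow> real) \<Rightarrow> ('k \<Rightarrow> 'i \<Rightarrow> 'j \<Rightarrow> 'k pmf)
    \<Rightarrow> real \<Rightarrow> 'k \<Rightarrow> real \<Rightarrow> real ^ ('k \<Rightarrow> 'j) ^ ('k \<Rightarrow> 'i)" where
  "W_matrix g q lam k z = (\<chi> ii jj. dk g q lam k ii jj - z * d0 q lam ii jj)"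

lemma measurable_history:
  "(\<lambda>\<omega>. map \<omega> [0..<m]) \<in>
     PiM {0..<m} (\<lambda>_. count_space (UNIV :: ('k::finite \<times> 'i::finite \<times> 'j::finite) set))
       \<rightarrow>\<^sub>M count_space UNIV"
proof -
  let ?M = "PiM {0..<m} (\<lambda>_. count_space (UNIV :: ('k \<times> 'i \<times> 'j) set))"
  have "n \<le> m \<Longrightarrow> (\<lambda>\<omega>. map \<omega> [0..<n]) \<in> ?M \<rightarrow>\<^sub>M count_space UNIV" for n
  proof (induction n)
    case (Suc n)
    have 1: "(\<lambda>\<omega>. map \<omega> [0..<n]) \<in> ?M \<rightarrow>\<^sub>M count_space UNIV"
      using Suc by simp
    have 2: "(\<lambda>\<omega>. \<omega> n) \<in> ?M \<rightarrow>\<^sub>M count_space UNIV"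
      using Suc.prems by (intro measurable_component_singleton) auto
    have "(\<lambda>\<omega>. (map \<omega> [0..<n], \<omega> n)) \<in> ?M \<rightarrow>\<^sub>M count_space UNIV \<Otimes>\<^sub>M count_space UNIV"
      using 1 2 by (rule measurable_Pair)
    then have "(\<lambda>\<omega>. (map \<omega> [0..<n], \<omega> n)) \<in> ?M \<rightarrow>\<^sub>M count_space UNIV"
      by (simp add: pair_measure_countable)
    from measurable_compose[OF this, of "\<lambda>(h, x). h @ [x]" "count_space UNIV"]
    show ?case by simp
  qed simp
  then show ?thesis by simp
qed

lemma Ionescu_Tulcea_stage_kernel:
  fixes q :: "'k::finite \<Rightarrow> 'i::finite \<Rightarrow> 'j::finite \<Rightarrow> 'k pmf"
  shows "Ionescu_Tulcea (stage_kernel q k \<sigma> \<tau>) (\<lambda>_. count_space UNIV)"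
proof (rule Ionescu_Tulcea.intro)
  show "stage_kernel q k \<sigma> \<tau> m
      \<in> PiM {0..<m} (\<lambda>_. count_space UNIV) \<rightarrow>\<^sub>M subprob_algebra (count_space UNIV)" for m
    unfolding stage_kernel_def[abs_def]
    by (rule measurable_compose[OF measurable_history])
       (auto simp: measure_pmf_in_subprob_algebra)
  show "prob_space (stage_kernel q k \<sigma> \<tau> m \<omega>)" for m \<omega>
    unfolding stage_kernel_def by (rule prob_space_measure_pmf)
qed

lemma
  fixes q :: "'k::finite \<Rightarrow> 'i::finite \<Rightarrow> 'j::finite \<Rightarrow> 'k pmf"
  shows sets_play_measure [measurable_cong]:
      "sets (play_measure q k \<sigma> \<tau>) = sets (PiM UNIV (\<lambda>_. count_space UNIV))"
    and space_play_measure: "space (play_measure q k \<sigma> \<tau>) = UNIV"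
    and prob_space_play_measure: "prob_space (play_measure q k \<sigma> \<tau>)"
    and distr_play_measure: "finite J \<Longrightarrow>
      distr (play_measure q k \<sigma> \<tau>) (PiM J (\<lambda>_. count_space UNIV)) (\<lambda>\<omega>. restrict \<omega> J) =
      Ionescu_Tulcea.CI (stage_kernel q k \<sigma> \<tau>) (\<lambda>_. count_space UNIV) J"
proof -
  interpret IT: Ionescu_Tulcea "stage_kernel q k \<sigma> \<tau>" "\<lambda>_. count_space UNIV"
    by (rule Ionescu_Tulcea_stage_kernel)
  show "sets (play_measure q k \<sigma> \<tau>) = sets (PiM UNIV (\<lambda>_. count_space UNIV))"
    by (simp add: play_measure_def)
  show sp: "space (play_measure q k \<sigma> \<tau>) = UNIV"
    by (simp add: play_measure_def space_PiM PiE_def)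
  show distr: "distr (play_measure q k \<sigma> \<tau>) (PiM J (\<lambda>_. count_space UNIV)) (\<lambda>\<omega>. restrict \<omega> J) =
      IT.CI J" if "finite J" for J
    unfolding play_measure_def using that by (rule IT.distr_lim)
  show "prob_space (play_measure q k \<sigma> \<tau>)"
  proof
    have "emeasure (IT.CI {}) (space (IT.CI {})) = 1"
      by (rule prob_space.emeasure_space_1[OF IT.PF.prob_space_P]) auto
    moreover have "IT.PF.emb UNIV {} (space (IT.CI {})) = UNIV"
      by (auto simp: prod_emb_def IT.PF.space_P space_PiM)
    ultimately show "emeasure (play_measure q k \<sigma> \<tau>) (space (play_measure q k \<sigma> \<tau>)) = 1"
      using IT.lim[of "{}" "space (IT.CI {})"]
      by (simp add: sp play_measure_def[symmetric] IT.PF.space_P)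
  qed
qed

lemma
  fixes g :: "'k::finite \<Rightarrow> 'i::finite \<Rightarrow> 'j::finite \<Rightarrow> real"
  assumes "0 < lam" "lam \<le> 1"
  shows summable_discounted_reward:
      "summable (\<lambda>m. lam * (1 - lam) ^ m * (case \<omega> m of (l, a, b) \<Rightarrow> g l a b))"
    and discounted_reward_bound:
      "\<bar>discounted_reward g lam \<omega>\<bar> \<le> (MAX (l, a, b)\<in>UNIV. \<bar>g l a b\<bar>)"
proof -
  define G where "G = (MAX (l, a, b)\<in>UNIV. \<bar>g l a b\<bar>)"
  let ?f = "\<lambda>m. lam * (1 - lam) ^ m * (case \<omega> m of (l, a, b) \<Rightarrow> g l a b)"
  have "(case x of (l, a, b) \<Rightarrow> \<bar>g l a b\<bar>) \<le> G" for x
    unfolding G_def by (intro Max_ge) auto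
  then have G: "\<bar>case x of (l, a, b) \<Rightarrow> g l a b\<bar> \<le> G" for x
    by (simp add: case_prod_beta)
  have le: "norm (?f m) \<le> (lam * G) * (1 - lam) ^ m" for m
    using assms mult_left_mono[OF G[of "\<omega> m"], of "lam * (1 - lam) ^ m"]
    by (simp add: abs_mult mult_ac)
  have sums: "(\<lambda>m. (lam * G) * (1 - lam) ^ m) sums ((lam * G) * (1 / (1 - (1 - lam))))"
    using assms by (intro sums_mult geometric_sums) auto
  then have sm: "summable (\<lambda>m. norm (?f m))"
    by (intro summable_comparison_test'[OF sums_summable[OF sums], of 0]) (use le in auto)
  then show "summable ?f"
    by (rule summable_norm_cancel)
  have "\<bar>\<Sum>m. ?f m\<bar> \<le> (\<Sum>m. norm (?f m))"
    using summable_norm[OF sm] by simp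
  also have "\<dots> \<le> (\<Sum>m. (lam * G) * (1 - lam) ^ m)"
    using le sm sums by (intro suminf_le sums_summable[OF sums]) auto
  also have "\<dots> = G"
    using sums_unique[OF sums] assms by simp
  finally show "\<bar>discounted_reward g lam \<omega>\<bar> \<le> (MAX (l, a, b)\<in>UNIV. \<bar>g l a b\<bar>)"
    by (simp add: discounted_reward_def G_def)
qed

lemma integrable_discounted_reward:
  fixes g :: "'k::finite \<Rightarrow> 'i::finite \<Rightarrow> 'j::finite \<Rightarrow> real"
  assumes "0 < lam" "lam \<le> 1"
  shows "integrable (play_measure q k \<sigma> \<tau>) (discounted_reward g lam)"
proof -
  interpret prob_space "play_measure q k \<sigma> \<tau>"
    by (rule prob_space_play_measure)
  have [measurable]: "(\<lambda>\<omega>. case \<omega> m of (l, a, b) \<Rightarrow> g l a b) \<in> borel_measurable (play_measure q k \<sigma> \<tau>)" for m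
  proof -
    have "(\<lambda>\<omega>. \<omega> m) \<in> play_measure q k \<sigma> \<tau> \<rightarrow>\<^sub>M count_space UNIV"
      by measurable
    from measurable_compose[OF this, of "\<lambda>(l, a, b). g l a b" borel] show ?thesis
      by simp
  qed
  have "discounted_reward g lam \<in> borel_measurable (play_measure q k \<sigma> \<tau>)"
    unfolding discounted_reward_def[abs_def] by measurable
  then show ?thesis
    using discounted_reward_bound[OF assms, of g]
    by (intro integrable_const_bound[where B = "MAX (l, a, b)\<in>UNIV. \<bar>g l a b\<bar>"]) auto
qed

end

theory Submission
  imports Defs
begin

text \<open>
  Brouwer's theorem, applied to Nash's improvement map on pairs \<open>(x, y)\<close> of stationary strategies
  together with a vector \<open>w\<close> that is updated to the one-shot payoff of \<open>x\<close> and \<open>y\<close> with continuation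
  \<open>w\<close>, yields \<open>x\<close> and \<open>y\<close> that are optimal in every one-shot game with continuation \<open>w\<close>. Hence
  \<open>w k\<close> is the value of the discounted game. Playing \<open>x\<close> independently across states averages
  determinants row by row, so against a pure stationary \<open>j\<close> the averaged \<open>d\<^sup>0\<close> and \<open>d\<^sup>k\<close> are the
  determinants attached to the Markov chain of \<open>(x, j)\<close>. By Cramer's rule the averaged entry
  \<open>d\<^sup>k - w\<^sup>k d\<^sup>0\<close> is then a positive determinant times the amount by which the payoff of \<open>(x, j)\<close>
  exceeds \<open>w\<^sup>k\<close>, which is nonnegative; with \<open>y\<close> the sign is reversed. Uniqueness holds because
  \<open>d\<^sup>0\<close> is bounded below by a positive constant.
\<close>

subsection \<open>Matrix games and determinants of discounted kernels\<close>

text \<open>The bound \<open>B\<close> supplies the bounded ranges that real suprema and infima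
  require. Together with \<open>SUP_INF_le\<close>, one guarantee for each player pins down a
  max-min value, both for matrix games and for the discounted game.\<close>

lemma SUP_INF_ge:
  fixes f :: "'a \<Rightarrow> 'b \<Rightarrow> real"
  assumes bound: "\<And>s t. \<bar>f s t\<bar> \<le> B" and ge: "\<And>t. c \<le> f s t"
  shows "c \<le> (SUP s. INF t. f s t)"
proof -
  have bdd: "bdd_below (range (f s'))" for s'
    using bound[of s'] by (intro bdd_belowI2[of _ "-B"]) (simp add: abs_le_iff minus_le_iff)
  have "(INF t. f s' t) \<le> B" for s'
    using cINF_lower[OF bdd UNIV_I] bound abs_le_D1 order_trans by blast
  then have "bdd_above (range (\<lambda>s. INF t. f s t))"
    by (intro bdd_aboveI2)
  then show ?thesis
    by (rule cSUP_upper2[where x = s]) (auto intro!: cINF_greatest ge)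
qed

lemma SUP_INF_le:
  fixes f :: "'a \<Rightarrow> 'b \<Rightarrow> real"
  assumes bound: "\<And>s t. \<bar>f s t\<bar> \<le> B" and le: "\<And>s. f s t \<le> c"
  shows "(SUP s. INF t. f s t) \<le> c"
proof (rule cSUP_least)
  fix s
  have "bdd_below (range (f s))"
    using bound[of s] by (intro bdd_belowI2[of _ "-B"]) (simp add: abs_le_iff minus_le_iff)
  then show "(INF t. f s t) \<le> c"
    by (rule cINF_lower2[where x = t]) (simp_all add: le)
qed simp

lemma abs_le_Max_UNIV:
  fixes f :: "'k::finite \<Rightarrow> 'i::finite \<Rightarrow> 'j::finite \<Rightarrow> real"
  shows "\<bar>f l a b\<bar> \<le> (MAX (l, a, b)\<in>UNIV. \<bar>f l a b\<bar>)"
proof -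
  have "(case (l, a, b) of (l, a, b) \<Rightarrow> \<bar>f l a b\<bar>) \<le> (MAX (l, a, b)\<in>UNIV. \<bar>f l a b\<bar>)"
    by (rule Max_ge, simp) (rule rangeI)
  then show ?thesis
    by simp
qed

lemma pmf_average_ge:
  fixes f :: "'a::finite \<Rightarrow> real"
  assumes "\<And>a. c \<le> f a"
  shows "c \<le> (\<Sum>a\<in>UNIV. pmf p a * f a)"
proof -
  have "c = (\<Sum>a\<in>UNIV. pmf p a * c)"
    by (simp add: sum_distrib_right[symmetric] sum_pmf_eq_1)
  also have "\<dots> \<le> (\<Sum>a\<in>UNIV. pmf p a * f a)"
    by (intro sum_mono mult_left_mono assms) auto
  finally show ?thesis .
qed

lemma pmf_average_le:
  fixes f :: "'a::finite \<Rightarrow> real"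
  assumes "\<And>a. f a \<le> c"
  shows "(\<Sum>a\<in>UNIV. pmf p a * f a) \<le> c"
  using pmf_average_ge[of "-c" "\<lambda>a. - f a" p] assms by (simp add: sum_negf)

lemma matrix_payoff_bound:
  fixes M :: "real ^ 'b::finite ^ 'a::finite"
  shows "\<bar>\<Sum>a\<in>UNIV. \<Sum>b\<in>UNIV. pmf s a * M $ a $ b * pmf t b\<bar> \<le> (\<Sum>a\<in>UNIV. \<Sum>b\<in>UNIV. \<bar>M $ a $ b\<bar>)"
proof -
  have "\<bar>pmf s a * m * pmf t b\<bar> \<le> \<bar>m\<bar>" for a b m
  proof -
    have "pmf s a * pmf t b \<le> 1"
      by (intro mult_le_one pmf_le_1) auto
    then have "(pmf s a * pmf t b) * \<bar>m\<bar> \<le> 1 * \<bar>m\<bar>"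
      by (intro mult_right_mono) auto
    then show ?thesis
      by (simp add: abs_mult mult_ac)
  qed
  then show ?thesis
    by (intro order_trans[OF sum_abs] sum_mono order_trans[OF sum_abs])
qed

text \<open>The payoff is linear in \<open>t\<close>, so a guarantee of \<open>s\<close> against
  every column holds against every mixture of columns. In \<open>W_matrix\<close> the columns are
  pure stationary strategies.\<close>

lemma matrix_val_ge:
  fixes M :: "real ^ 'b::finite ^ 'a::finite"
  assumes "\<And>b. c \<le> (\<Sum>a\<in>UNIV. pmf s a * M $ a $ b)"
  shows "c \<le> matrix_val M"
proof -
  have "(\<Sum>a\<in>UNIV. \<Sum>b\<in>UNIV. pmf s a * M $ a $ b * pmf t b) =
      (\<Sum>b\<in>UNIV. pmf t b * (\<Sum>a\<in>UNIV. pmf s a * M $ a $ b))" for t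
    by (subst sum.swap) (simp add: sum_distrib_left mult_ac)
  then have "c \<le> (\<Sum>a\<in>UNIV. \<Sum>b\<in>UNIV. pmf s a * M $ a $ b * pmf t b)" for t
    using pmf_average_ge[OF assms] by simp
  then show ?thesis
    unfolding matrix_val_def by (intro SUP_INF_ge[OF matrix_payoff_bound])
qed

lemma matrix_val_le:
  fixes M :: "real ^ 'b::finite ^ 'a::finite"
  assumes "\<And>a. (\<Sum>b\<in>UNIV. pmf t b * M $ a $ b) \<le> c"
  shows "matrix_val M \<le> c"
proof -
  have "(\<Sum>a\<in>UNIV. \<Sum>b\<in>UNIV. pmf s a * M $ a $ b * pmf t b) =
      (\<Sum>a\<in>UNIV. pmf s a * (\<Sum>b\<in>UNIV. pmf t b * M $ a $ b))" for s
    by (simp add: sum_distrib_left mult_ac)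
  then have "(\<Sum>a\<in>UNIV. \<Sum>b\<in>UNIV. pmf s a * M $ a $ b * pmf t b) \<le> c" for s
    using pmf_average_le[OF assms] by simp
  then show ?thesis
    unfolding matrix_val_def by (intro SUP_INF_le[OF matrix_payoff_bound])
qed

section \<open>Discounted stochastic kernels\<close>

text \<open>Minimum principle: at a state \<open>l0\<close> minimizing \<open>u\<close>, the
  \<open>Q\<close>-average of \<open>u\<close> is at least \<open>u $ l0\<close>, so the hypothesis
  at \<open>l0\<close> yields \<open>0 \<le> (1 - c) * u $ l0\<close>.\<close>

lemma discounted_kernel_nonneg:
  fixes Q :: "real ^ 'k::finite ^ 'k"
  assumes c: "0 \<le> c" "c < 1"
    and Q: "\<And>l l'. 0 \<le> Q $ l $ l'" "\<And>l. (\<Sum>l'\<in>UNIV. Q $ l $ l') = 1"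
    and u: "\<And>l. 0 \<le> ((mat 1 - c *\<^sub>R Q) *v u) $ l"
  shows "0 \<le> u $ l"
proof -
  define l0 where "l0 = (ARG_MIN (\<lambda>l. u $ l) l. l \<in> UNIV)"
  have min: "u $ l0 \<le> u $ l" for l
    using arg_min_least[of UNIV l "\<lambda>l. u $ l"] by (simp add: l0_def arg_min_on_def)
  have "((mat 1 - c *\<^sub>R Q) *v u) $ l0 = u $ l0 - c * (\<Sum>l'\<in>UNIV. Q $ l0 $ l' * u $ l')"
    by (simp add: matrix_vector_mult_def mat_def left_diff_distrib sum_subtractf sum_distrib_left
      mult.assoc if_distrib[of "\<lambda>x. x * _"] cong: if_cong)
  moreover have "u $ l0 = (\<Sum>l'\<in>UNIV. Q $ l0 $ l' * u $ l0)"
    by (simp add: sum_distrib_right[symmetric] Q)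
  moreover have "\<dots> \<le> (\<Sum>l'\<in>UNIV. Q $ l0 $ l' * u $ l')"
    by (intro sum_mono mult_left_mono min Q)
  ultimately have "c * u $ l0 \<le> u $ l0"
    using u[of l0] c by (smt (verit) mult_left_mono)
  then have "0 \<le> (1 - c) * u $ l0"
    by (simp add: algebra_simps)
  then have "0 \<le> u $ l0"
    using c by (simp add: zero_le_mult_iff)
  then show ?thesis
    using min order_trans by blast
qed

text \<open>The minimum principle, applied to a kernel vector and to its negative, makes the kernel
  trivial.\<close>

lemma discounted_kernel_det_nonzero:
  fixes Q :: "real ^ 'k::finite ^ 'k"
  assumes c: "0 \<le> c" "c < 1"
    and Q: "\<And>l l'. 0 \<le> Q $ l $ l'" "\<And>l. (\<Sum>l'\<in>UNIV. Q $ l $ l') = 1"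
  shows "det (mat 1 - c *\<^sub>R Q) \<noteq> 0"
proof -
  have "u = 0" if "(mat 1 - c *\<^sub>R Q) *v u = 0" for u
  proof -
    have "0 \<le> u $ l" for l
      by (rule discounted_kernel_nonneg[OF c Q]) (simp_all add: that)
    moreover have "0 \<le> (- u) $ l" for l
      by (rule discounted_kernel_nonneg[OF c Q])
        (simp_all add: that linear_neg[OF matrix_vector_mul_linear])
    ultimately show ?thesis
      by (simp add: vec_eq_iff order_antisym)
  qed
  then have "invertible (mat 1 - c *\<^sub>R Q)"
    unfolding invertible_left_inverse matrix_left_invertible_ker by blast
  then show ?thesis
    by (simp add: invertible_det_nz)
qed

text \<open>Homotopy to the identity: the determinant is 1 at \<open>t = 0\<close> and vanishes
  nowhere up to \<open>c\<close>, so by the intermediate value theorem it stays positive.\<close>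

lemma discounted_kernel_det_pos:
  fixes Q :: "real ^ 'k::finite ^ 'k"
  assumes c: "0 \<le> c" "c < 1"
    and Q: "\<And>l l'. 0 \<le> Q $ l $ l'" "\<And>l. (\<Sum>l'\<in>UNIV. Q $ l $ l') = 1"
  shows "0 < det (mat 1 - c *\<^sub>R Q)"
proof (rule ccontr)
  assume "\<not> ?thesis"
  moreover have "continuous_on {0..c} (\<lambda>t. det (mat 1 - t *\<^sub>R Q))"
    unfolding det_def by (auto intro!: continuous_intros)
  ultimately have "\<exists>t\<ge>0. t \<le> c \<and> det (mat 1 - t *\<^sub>R Q) = 0"
    using c by (intro IVT2') auto
  then show False
    using discounted_kernel_det_nonzero[OF _ _ Q] c by force
qed

text \<open>In the Leibniz formula each permutation takes exactly one entry from each row. Row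
  \<open>l\<close> depends only on \<open>f l\<close>, and these choices are independent under
  \<open>Pi_pmf\<close>, so the expectation passes through the product.\<close>

lemma expectation_det_rows:
  fixes M :: "'k::finite \<Rightarrow> 'a::finite \<Rightarrow> 'k \<Rightarrow> real"
  shows "(\<Sum>f\<in>UNIV. pmf (Pi_pmf UNIV dflt x) f * det (\<chi> l l'. M l (f l) l')) =
    det (\<chi> l l'. \<Sum>a\<in>UNIV. pmf (x l) a * M l a l')"
proof -
  have "(\<Sum>f\<in>UNIV. pmf (Pi_pmf UNIV dflt x) f * det (\<chi> l l'. M l (f l) l')) =
      (\<Sum>f\<in>UNIV. \<Sum>p | p permutes UNIV. of_int (sign p) * (\<Prod>l\<in>UNIV. pmf (x l) (f l) * M l (f l) (p l)))"
    by (simp add: pmf_Pi det_def sum_distrib_left prod.distrib mult_ac)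
  also have "\<dots> = (\<Sum>p | p permutes UNIV. of_int (sign p) *
      (\<Sum>f\<in>UNIV. \<Prod>l\<in>UNIV. pmf (x l) (f l) * M l (f l) (p l)))"
    by (subst sum.swap) (simp add: sum_distrib_left)
  also have "\<dots> = det (\<chi> l l'. \<Sum>a\<in>UNIV. pmf (x l) a * M l a l')"
    by (simp add: det_def prod_sum_PiE PiE_UNIV_domain)
  finally show ?thesis .
qed

subsection \<open>Stationary equilibria\<close>

text \<open>Payoff entry of Shapley's auxiliary one-shot game at state \<open>l\<close> with
  continuation payoffs \<open>w\<close>.\<close>

definition shapley_entry ::
  "('k::finite \<Rightarrow> 'i \<Rightarrow> 'j \<Rightarrow> real) \<Rightarrow> ('k \<Rightarrow> 'i \<Rightarrow> 'j \<Rightarrow> 'k pmf) \<Rightarrow> real \<Rightarrow> ('k \<Rightarrow> real)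
    \<Rightarrow> 'k \<Rightarrow> 'i \<Rightarrow> 'j \<Rightarrow> real" where
  "shapley_entry g q lam w l a b = lam * g l a b + (1 - lam) * (\<Sum>l'\<in>UNIV. pmf (q l a b) l' * w l')"

text \<open>Vectors rather than \<open>pmf\<close>s, because Brouwer's theorem is applied to a
  compact convex subset of a Euclidean space; \<open>mixed_profiles_pmf\<close> translates
  back.\<close>

definition mixed_profiles :: "(real ^ 'a::finite ^ 'k::finite) set" where
  "mixed_profiles = {x. \<forall>l. (\<forall>a. 0 \<le> x $ l $ a) \<and> (\<Sum>a\<in>UNIV. x $ l $ a) = 1}"

text \<open>Here \<open>\<phi> l a\<close> stands for the gain from deviating to \<open>a\<close> at
  state \<open>l\<close>. Profitable actions receive extra weight, the positive part keeps the map
  continuous, and the denominator restores total mass 1.\<close>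

definition nash_step ::
  "('k::finite \<Rightarrow> 'a::finite \<Rightarrow> real) \<Rightarrow> real ^ 'a ^ 'k \<Rightarrow> real ^ 'a ^ 'k" where
  "nash_step \<phi> x =
     (\<chi> l a. (x $ l $ a + max 0 (\<phi> l a)) / (1 + (\<Sum>a'\<in>UNIV. max 0 (\<phi> l a'))))"

lemma mixed_profiles_pmf:
  assumes "x \<in> mixed_profiles"
  obtains p where "\<And>l a. pmf (p l) a = x $ l $ a"
proof
  fix l a
  show "pmf (embed_pmf (\<lambda>a. x $ l $ a)) a = x $ l $ a"
    using assms
    by (intro pmf_embed_pmf)
      (auto simp: mixed_profiles_def nn_integral_count_space_finite sum_ennreal ennreal_1[symmetric]
        simp del: ennreal_1)
qed

lemma convex_mixed_profiles: "convex mixed_profiles"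
  by (auto simp: convex_def mixed_profiles_def sum.distrib sum_distrib_left[symmetric])

lemma mixed_profiles_nonempty:
  "(mixed_profiles :: (real ^ 'a::finite ^ 'k::finite) set) \<noteq> {}"
proof -
  have "(\<chi> l a. if a = undefined then 1 else 0) \<in> (mixed_profiles :: (real ^ 'a ^ 'k) set)"
    by (simp add: mixed_profiles_def)
  then show ?thesis
    by blast
qed

lemma compact_mixed_profiles:
  "compact (mixed_profiles :: (real ^ 'a::finite ^ 'k::finite) set)"
proof -
  have "norm x \<le> real CARD('k)" if "x \<in> mixed_profiles" for x :: "real ^ 'a ^ 'k"
  proof -
    have "norm (x $ l) \<le> 1" for l
      using norm_le_l1_cart[of "x $ l"] that by (simp add: mixed_profiles_def)
    then have "(\<Sum>l\<in>UNIV. norm (x $ l)) \<le> (\<Sum>l\<in>(UNIV :: 'k set). 1)"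
      by (intro sum_mono) auto
    moreover have "norm x \<le> (\<Sum>l\<in>UNIV. norm (x $ l))"
      unfolding norm_vec_def by (rule L2_set_le_sum) simp
    ultimately show ?thesis
      by simp
  qed
  then have "bounded (mixed_profiles :: (real ^ 'a ^ 'k) set)"
    by (auto simp: bounded_iff)
  moreover have "closed (mixed_profiles :: (real ^ 'a ^ 'k) set)"
    unfolding mixed_profiles_def
    by (intro closed_Collect_all closed_Collect_conj closed_Collect_le closed_Collect_eq continuous_intros)
  ultimately show ?thesis
    by (simp add: compact_eq_bounded_closed)
qed

lemma nash_step_mem:
  assumes "x \<in> mixed_profiles"
  shows "nash_step \<phi> x \<in> mixed_profiles"
proof -
  have "0 \<le> (\<Sum>a\<in>UNIV. max 0 (\<phi> l a))" for l
    by (intro sum_nonneg) auto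
  then have pos: "1 + (\<Sum>a\<in>UNIV. max 0 (\<phi> l a)) > 0" for l
    by (simp add: add_pos_nonneg)
  then have "1 + (\<Sum>a\<in>UNIV. max 0 (\<phi> l a)) \<noteq> 0" for l
    by (metis less_irrefl)
  with assms pos show ?thesis
    by (auto simp: mixed_profiles_def nash_step_def sum_divide_distrib[symmetric] sum.distrib
        intro!: divide_nonneg_pos add_nonneg_nonneg)
qed

text \<open>
  If the average gain is zero, a fixed point satisfies \<open>\<phi>\<^sup>+ = S x\<close> with \<open>S = \<Sum>\<phi>\<^sup>+\<close>, so
  \<open>\<Sum>(\<phi>\<^sup>+)\<^sup>2 = S \<Sum>x \<phi> = 0\<close>.
\<close>

lemma nash_step_fixed_point:
  assumes fixed: "nash_step \<phi> x = x" and avg: "(\<Sum>a\<in>UNIV. x $ l $ a * \<phi> l a) = 0"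
  shows "\<phi> l a \<le> 0"
proof -
  define S where "S = (\<Sum>a\<in>UNIV. max 0 (\<phi> l a))"
  have "0 \<le> S"
    unfolding S_def by (intro sum_nonneg) auto
  have "x $ l $ a = (x $ l $ a + max 0 (\<phi> l a)) / (1 + S)" for a
    using arg_cong[OF fixed, of "\<lambda>x. x $ l $ a"] by (simp add: nash_step_def S_def)
  then have S: "max 0 (\<phi> l a) = S * x $ l $ a" for a
    using \<open>0 \<le> S\<close> by (simp add: field_simps)
  have "(\<Sum>a\<in>UNIV. (max 0 (\<phi> l a))\<^sup>2) = (\<Sum>a\<in>UNIV. max 0 (\<phi> l a) * \<phi> l a)"
    by (intro sum.cong) (auto simp: max_def power2_eq_square)
  also have "\<dots> = S * (\<Sum>a\<in>UNIV. x $ l $ a * \<phi> l a)"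
    by (simp add: S sum_distrib_left mult_ac)
  finally have "(max 0 (\<phi> l a))\<^sup>2 = 0"
    using avg by (simp add: sum_nonneg_eq_0_iff)
  then show ?thesis
    by (simp add: max_def split: if_splits)
qed

lemma continuous_on_nash_step:
  assumes "\<And>l a. continuous_on S (\<lambda>p. \<phi> p l a)" and "continuous_on S x"
  shows "continuous_on S (\<lambda>p. nash_step (\<phi> p) (x p))"
proof -
  have "0 \<le> (\<Sum>a\<in>UNIV. max 0 (\<phi> p l a))" for p l
    by (intro sum_nonneg) auto
  then have "1 + (\<Sum>a\<in>UNIV. max 0 (\<phi> p l a)) > 0" for p l
    by (simp add: add_pos_nonneg)
  then have "1 + (\<Sum>a\<in>UNIV. max 0 (\<phi> p l a)) \<noteq> 0" for p l
    by (metis less_irrefl)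
  then show ?thesis
    unfolding nash_step_def
    by (intro continuous_on_vec_lambda continuous_intros assms) auto
qed

text \<open>The entry is a convex combination of a reward and an average of continuation payoffs.
  This keeps the updated \<open>w\<close> inside the cube \<open>Box\<close> to which Brouwer's
  theorem is applied.\<close>

lemma abs_shapley_entry_le:
  assumes lam: "0 < lam" "lam \<le> 1" and g: "\<bar>g l a b\<bar> \<le> G" and w: "\<And>l. \<bar>w l\<bar> \<le> G"
  shows "\<bar>shapley_entry g q lam w l a b\<bar> \<le> G"
proof -
  have w': "- G \<le> w l \<and> w l \<le> G" for l
    using w[of l] by (simp add: abs_le_iff)
  have "\<bar>\<Sum>l'\<in>UNIV. pmf (q l a b) l' * w l'\<bar> \<le> G"
    using pmf_average_ge[of "-G" w] pmf_average_le[of w G] w' by (simp add: abs_le_iff minus_le_iff)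
  then have "\<bar>shapley_entry g q lam w l a b\<bar> \<le> lam * G + (1 - lam) * G"
    unfolding shapley_entry_def using lam g
    by (intro order_trans[OF abs_triangle_ineq] add_mono) (auto simp: abs_mult intro!: mult_left_mono)
  then show ?thesis
    by (simp add: algebra_simps)
qed

text \<open>Carrying \<open>w\<close> along lets one fixed point deliver Shapley's equation together
  with optimal strategies: fixedness of \<open>w\<close> makes both average gains zero, and
  fixedness under \<open>nash_step\<close> then makes every single gain nonpositive.\<close>

lemma stationary_equilibrium:
  fixes g :: "'k::finite \<Rightarrow> 'i::finite \<Rightarrow> 'j::finite \<Rightarrow> real"
  assumes lam: "0 < lam" "lam \<le> 1"
  obtains x :: "'k \<Rightarrow> 'i pmf" and y :: "'k \<Rightarrow> 'j pmf" and w :: "'k \<Rightarrow> real"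
  where "\<And>l b. w l \<le> (\<Sum>a\<in>UNIV. pmf (x l) a * shapley_entry g q lam w l a b)"
    and "\<And>l a. (\<Sum>b\<in>UNIV. pmf (y l) b * shapley_entry g q lam w l a b) \<le> w l"
proof -
  define G where "G = (MAX (l, a, b)\<in>UNIV. \<bar>g l a b\<bar>)"
  have G: "\<bar>g l a b\<bar> \<le> G" for l a b
    unfolding G_def by (rule abs_le_Max_UNIV)
  \<comment> \<open>Makes \<open>Box\<close> nonempty, as Brouwer's theorem requires of
    \<open>S\<close>.\<close>
  have "0 \<le> G"
    using G[of undefined undefined undefined] by linarith
  define r where "r w l a b = shapley_entry g q lam (\<lambda>l. w $ l) l a b" for w l a b
  \<comment> \<open>Gains are measured against the component \<open>w\<close> of \<open>p\<close>,
    which agrees with the current payoff \<open>val\<close> at a fixed point. The sign in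
    \<open>gain2\<close> is opposite because Player 2 minimizes.\<close>
  define gain1 where "gain1 p l a = (\<Sum>b\<in>UNIV. fst (snd p) $ l $ b * r (snd (snd p)) l a b) - snd (snd p) $ l"
    for p :: "(real ^ 'i ^ 'k) \<times> (real ^ 'j ^ 'k) \<times> (real ^ 'k)" and l a
  define gain2 where "gain2 p l b = snd (snd p) $ l - (\<Sum>a\<in>UNIV. fst p $ l $ a * r (snd (snd p)) l a b)"
    for p :: "(real ^ 'i ^ 'k) \<times> (real ^ 'j ^ 'k) \<times> (real ^ 'k)" and l b
  define val where "val p l = (\<Sum>a\<in>UNIV. fst p $ l $ a * (\<Sum>b\<in>UNIV. fst (snd p) $ l $ b * r (snd (snd p)) l a b))"
    for p :: "(real ^ 'i ^ 'k) \<times> (real ^ 'j ^ 'k) \<times> (real ^ 'k)" and l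
  define F where "F p = (nash_step (gain1 p) (fst p), nash_step (gain2 p) (fst (snd p)), \<chi> l. val p l)" for p
  define Box where "Box = cbox (\<chi> l. - G) (\<chi> l. G :: real ^ 'k)"
  have Box: "w \<in> Box \<longleftrightarrow> (\<forall>l. \<bar>w $ l\<bar> \<le> G)" for w
    by (auto simp: Box_def mem_box_cart abs_le_iff minus_le_iff)
  define S where "S = (mixed_profiles :: (real ^ 'i ^ 'k) set) \<times> (mixed_profiles :: (real ^ 'j ^ 'k) set) \<times> Box"
  have "val p l \<in> {-G..G}" if "p \<in> S" for p l
  proof -
    from that have "fst p \<in> mixed_profiles" "fst (snd p) \<in> mixed_profiles" and w: "snd (snd p) \<in> Box"
      by (auto simp: S_def)
    then obtain x y where xy: "\<And>l a. pmf (x l) a = fst p $ l $ a" "\<And>l b. pmf (y l) b = fst (snd p) $ l $ b"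
      by (metis mixed_profiles_pmf)
    have "\<bar>r (snd (snd p)) l a b\<bar> \<le> G" for a b
      unfolding r_def using w Box by (intro abs_shapley_entry_le lam G) auto
    then have "- G \<le> r (snd (snd p)) l a b" "r (snd (snd p)) l a b \<le> G" for a b
      by (simp_all add: abs_le_iff minus_le_iff)
    then show ?thesis
      unfolding val_def xy[symmetric] by (auto intro!: pmf_average_ge pmf_average_le)
  qed
  then have "F \<in> S \<rightarrow> S"
    by (auto simp: F_def S_def Box abs_le_iff minus_le_iff intro!: nash_step_mem)
  moreover have "continuous_on S F"
    unfolding F_def gain1_def gain2_def val_def r_def shapley_entry_def
    by (intro continuous_on_vec_lambda continuous_on_nash_step continuous_intros)
  moreover have "compact S" "convex S" "S \<noteq> {}"
    using \<open>0 \<le> G\<close> Box[of 0] unfolding S_def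
    by (auto intro!: compact_Times convex_Times simp: compact_mixed_profiles convex_mixed_profiles
        mixed_profiles_nonempty Box_def)
  ultimately obtain p where p: "p \<in> S" "F p = p"
    by (rule_tac brouwer)
  obtain x y w where pxyw: "p = (x, y, w)"
    by (cases p)
  from p have mem: "x \<in> mixed_profiles" "y \<in> mixed_profiles"
    and fixed: "nash_step (gain1 p) x = x" "nash_step (gain2 p) y = y"
    and w: "w = (\<chi> l. val p l)"
    by (auto simp: S_def F_def pxyw)
  have w: "w $ l = (\<Sum>a\<in>UNIV. x $ l $ a * (\<Sum>b\<in>UNIV. y $ l $ b * r w l a b))" for l
    using arg_cong[OF w, of "\<lambda>w. w $ l"] by (simp add: val_def pxyw)
  have "(\<Sum>a\<in>UNIV. x $ l $ a * gain1 p l a) = w $ l - (\<Sum>a\<in>UNIV. x $ l $ a) * w $ l" for l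
    by (simp add: gain1_def pxyw right_diff_distrib sum_subtractf sum_distrib_right w[of l, symmetric])
  then have 1: "gain1 p l a \<le> 0" for l a
    using mem by (intro nash_step_fixed_point[OF fixed(1)]) (simp add: mixed_profiles_def)
  have "(\<Sum>b\<in>UNIV. y $ l $ b * (\<Sum>a\<in>UNIV. x $ l $ a * r w l a b)) = w $ l" for l
    by (subst w, simp add: sum_distrib_left mult.left_commute) (rule sum.swap)
  then have "(\<Sum>b\<in>UNIV. y $ l $ b * gain2 p l b) = (\<Sum>b\<in>UNIV. y $ l $ b) * w $ l - w $ l" for l
    by (simp add: gain2_def pxyw right_diff_distrib sum_subtractf sum_distrib_right)
  then have 2: "gain2 p l b \<le> 0" for l b
    using mem by (intro nash_step_fixed_point[OF fixed(2)]) (simp add: mixed_profiles_def)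
  from mem obtain x' y' where "\<And>l a. pmf (x' l) a = x $ l $ a" "\<And>l b. pmf (y' l) b = y $ l $ b"
    by (metis mixed_profiles_pmf)
  with 1 2 show ?thesis
    by (intro that[of "\<lambda>l. w $ l" x' y']) (simp_all add: gain1_def gain2_def pxyw r_def)
qed

section \<open>Averaged determinants against a fixed opponent\<close>

text \<open>The opponent's pure stationary strategy is absorbed into \<open>h\<close> and
  \<open>p\<close>, so that one lemma serves both players; \<open>e\<close> is the one-shot excess
  over \<open>w\<close>. The proof writes \<open>T\<close> as \<open>u $ k * det A\<close>, where
  \<open>A\<close> maps \<open>u\<close> to \<open>e\<close>, and the minimum principle transfers
  the sign of \<open>e\<close> to \<open>u\<close>.\<close>

lemma mixed_determinants_sign:
  fixes h :: "'k::finite \<Rightarrow> 'a::finite \<Rightarrow> real" and p :: "'k \<Rightarrow> 'a \<Rightarrow> 'k pmf" and x :: "'k \<Rightarrow> 'a pmf"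
    and w :: "'k \<Rightarrow> real" and k :: 'k and dflt :: 'a
  assumes lam: "0 < lam" "lam \<le> 1"
  defines "D \<equiv> \<lambda>f. mat 1 - (1 - lam) *\<^sub>R (\<chi> l l'. pmf (p l (f l)) l') :: real ^ 'k ^ 'k"
  defines "N \<equiv> \<lambda>f. (\<chi> l l'. if l' = k then lam * h l (f l) else D f $ l $ l') :: real ^ 'k ^ 'k"
  defines "e \<equiv> \<lambda>l. (\<Sum>a\<in>UNIV. pmf (x l) a * (lam * h l a + (1 - lam) * (\<Sum>l'\<in>UNIV. pmf (p l a) l' * w l'))) - w l"
  defines "T \<equiv> (\<Sum>f\<in>UNIV. pmf (Pi_pmf UNIV dflt x) f * (det (N f) - w k * det (D f)))"
  shows "(\<And>l. 0 \<le> e l) \<Longrightarrow> 0 \<le> T" and "(\<And>l. e l \<le> 0) \<Longrightarrow> T \<le> 0"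
proof -
  \<comment> \<open>Transition matrix of the chain in which the action at \<open>l\<close> is drawn
    afresh from \<open>x l\<close> at each visit.\<close>
  define Q where "Q = (\<chi> l l'. \<Sum>a\<in>UNIV. pmf (x l) a * pmf (p l a) l')"
  define A where "A = mat 1 - (1 - lam) *\<^sub>R Q"
  have Q: "0 \<le> Q $ l $ l'" "(\<Sum>l'\<in>UNIV. Q $ l $ l') = 1" for l l'
    unfolding Q_def
    by (auto intro!: sum_nonneg)
       (subst sum.swap, simp add: sum_distrib_left[symmetric] sum_pmf_eq_1)
  have c: "0 \<le> 1 - lam" "1 - lam < 1"
    using lam by auto
  have A_entry: "(\<Sum>a\<in>UNIV. pmf (x l) a * ((if l = l' then 1 else 0) - (1 - lam) * pmf (p l a) l')) = A $ l $ l'" for l l'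
    by (simp add: A_def Q_def mat_def right_diff_distrib sum_subtractf sum_distrib_right[symmetric]
        sum_distrib_left[symmetric] sum_pmf_eq_1 mult.left_commute)
  have D: "D f $ l $ l' = (if l = l' then 1 else 0) - (1 - lam) * pmf (p l (f l)) l'" for f l l'
    by (simp add: D_def mat_def)
  then have "D f = (\<chi> l l'. (if l = l' then 1 else 0) - (1 - lam) * pmf (p l (f l)) l')" for f
    by (simp add: vec_eq_iff)
  then have det_D: "(\<Sum>f\<in>UNIV. pmf (Pi_pmf UNIV dflt x) f * det (D f)) = det A"
    using expectation_det_rows[of dflt x "\<lambda>l a l'. (if l = l' then 1 else 0) - (1 - lam) * pmf (p l a) l'"]
    by (simp add: A_entry)
  define b where "b = (\<chi> l. lam * (\<Sum>a\<in>UNIV. pmf (x l) a * h l a))"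
  have N_entry: "(\<Sum>a\<in>UNIV. pmf (x l) a * (if l' = k then lam * h l a
      else (if l = l' then 1 else 0) - (1 - lam) * pmf (p l a) l')) = (if l' = k then b $ l else A $ l $ l')" for l l'
    by (cases "l' = k") (simp_all add: b_def sum_distrib_left mult.left_commute A_entry)
  \<comment> \<open>Replacing column \<open>k\<close> leaves row \<open>l\<close> a function of
    \<open>f l\<close> alone, so averaging row by row applies again.\<close>
  have det_N: "(\<Sum>f\<in>UNIV. pmf (Pi_pmf UNIV dflt x) f * det (N f)) = det (\<chi> l l'. if l' = k then b $ l else A $ l $ l')"
    using expectation_det_rows[of dflt x "\<lambda>l a l'. if l' = k then lam * h l a else (if l = l' then 1 else 0) - (1 - lam) * pmf (p l a) l'"]
    unfolding N_entry N_def D by simp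
  have "invertible A"
    using discounted_kernel_det_pos[OF c Q] by (simp add: invertible_det_nz A_def)
  then obtain u where u: "A *v u = (\<chi> l. e l)"
    by (metis invertible_right_inverse matrix_vector_mul_assoc matrix_vector_mul_lid)
  \<comment> \<open>Thus \<open>w + u\<close> is the discounted payoff vector of the averaged chain
    and \<open>u\<close> its excess over \<open>w\<close>; Cramer's rule reads off coordinate
    \<open>k\<close>.\<close>
  have b: "(A *v ((\<chi> l. w l) + u)) $ l = b $ l" for l
  proof -
    have "(\<Sum>l'\<in>UNIV. Q $ l $ l' * w l') = (\<Sum>a\<in>UNIV. pmf (x l) a * (\<Sum>l'\<in>UNIV. pmf (p l a) l' * w l'))"
      unfolding Q_def by (simp add: sum_distrib_right sum_distrib_left mult.assoc) (rule sum.swap)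
    moreover have "(A *v (\<chi> l. w l)) $ l = w l - (1 - lam) * (\<Sum>l'\<in>UNIV. Q $ l $ l' * w l')"
      by (simp add: A_def matrix_vector_mult_def mat_def left_diff_distrib sum_subtractf sum_distrib_left
        mult.assoc if_distrib[of "\<lambda>x. x * _"] cong: if_cong)
    moreover have "e l = b $ l + (1 - lam) * (\<Sum>a\<in>UNIV. pmf (x l) a * (\<Sum>l'\<in>UNIV. pmf (p l a) l' * w l')) - w l"
      by (simp add: e_def b_def distrib_left sum.distrib sum_distrib_left mult.left_commute)
    ultimately show ?thesis
      by (simp add: matrix_vector_right_distrib u)
  qed
  then have "det (\<chi> l l'. if l' = k then b $ l else A $ l $ l') = (w k + u $ k) * det A"
    using cramer_lemma[of k A "(\<chi> l. w l) + u"] unfolding b by simp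
  moreover have "T = (\<Sum>f\<in>UNIV. pmf (Pi_pmf UNIV dflt x) f * det (N f)) -
      w k * (\<Sum>f\<in>UNIV. pmf (Pi_pmf UNIV dflt x) f * det (D f))"
    by (simp add: T_def right_diff_distrib sum_subtractf sum_distrib_left mult.left_commute)
  ultimately have T: "T = u $ k * det A"
    unfolding det_N det_D by (simp add: algebra_simps)
  have pos: "0 < det A"
    unfolding A_def by (rule discounted_kernel_det_pos[OF c Q])
  show "0 \<le> T" if "\<And>l. 0 \<le> e l"
    using discounted_kernel_nonneg[OF c Q, of u k] that pos u by (simp add: T A_def)
  show "T \<le> 0" if "\<And>l. e l \<le> 0"
  proof -
    have "A *v (- u) = - (\<chi> l. e l)"
      by (simp add: linear_neg[OF matrix_vector_mul_linear] u)
    then show ?thesis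
      using discounted_kernel_nonneg[OF c Q, of "- u" k] that pos
      by (simp add: T A_def mult_le_0_iff)
  qed
qed

subsection \<open>The law of the play\<close>

text \<open>Finite-horizon form of the play, built from the same one-step laws as the Ionescu-Tulcea
  limit. Over finite types its supports are finite, so expectations become finite sums.\<close>

primrec history_law ::
  "('k \<Rightarrow> 'i \<Rightarrow> 'j \<Rightarrow> 'k pmf) \<Rightarrow> 'k \<Rightarrow> ('k, 'i, 'j, 'i) strategy \<Rightarrow> ('k, 'i, 'j, 'j) strategy
    \<Rightarrow> nat \<Rightarrow> ('k \<times> 'i \<times> 'j) list pmf" where
  "history_law q k \<sigma> \<tau> 0 = return_pmf []"
| "history_law q k \<sigma> \<tau> (Suc m) =
     bind_pmf (history_law q k \<sigma> \<tau> m) (\<lambda>h. map_pmf (\<lambda>x. h @ [x]) (stage_law q k \<sigma> \<tau> h))"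

lemma finite_set_history_law:
  fixes q :: "'k::finite \<Rightarrow> 'i::finite \<Rightarrow> 'j::finite \<Rightarrow> 'k pmf"
  shows "finite (set_pmf (history_law q k \<sigma> \<tau> m))"
  by (induction m) auto

text \<open>The marginal of the limit on the first \<open>m\<close> coordinates is the composition
  of the first \<open>m\<close> kernels, which obeys the recursion of \<open>history_law\<close>.
  Nonnegative integrals allow an arbitrary \<open>f\<close> without integrability
  conditions.\<close>

lemma nn_integral_history:
  fixes q :: "'k::finite \<Rightarrow> 'i::finite \<Rightarrow> 'j::finite \<Rightarrow> 'k pmf"
  shows "(\<integral>\<^sup>+\<omega>. f (map \<omega> [0..<m]) \<partial>play_measure q k \<sigma> \<tau>) =
    (\<integral>\<^sup>+h. f h \<partial>history_law q k \<sigma> \<tau> m)"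
proof -
  interpret IT: Ionescu_Tulcea "stage_kernel q k \<sigma> \<tau>" "\<lambda>_. count_space UNIV"
    by (rule Ionescu_Tulcea_stage_kernel)
  let ?M = "\<lambda>n. PiM {0..<n} (\<lambda>_. count_space UNIV) :: (nat \<Rightarrow> 'k \<times> 'i \<times> 'j) measure"
  have meas: "(\<lambda>\<omega>. f (map \<omega> [0..<n])) \<in> borel_measurable (?M n)" for n and f :: "_ \<Rightarrow> ennreal"
    by (rule measurable_compose[OF measurable_history]) simp
  \<comment> \<open>\<open>emeasure_CI\<close> evaluates a set through its cylinder extension, which
    is the set itself when the index set is already \<open>{0..<n}\<close>.\<close>
  have CI: "IT.CI {0..<n} = IT.C 0 n (\<lambda>_. undefined)" for n
  proof (rule measure_eqI)
    show "sets (IT.CI {0..<n}) = sets (IT.C 0 n (\<lambda>_. undefined))"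
      by (simp add: IT.PF.sets_P IT.sets_C space_PiM)
    fix X assume "X \<in> sets (IT.CI {0..<n})"
    then have X: "X \<in> sets (?M n)"
      by (simp add: IT.PF.sets_P)
    then have "X \<subseteq> (\<Pi>\<^sub>E i\<in>{0..<n}. space (count_space UNIV))"
      using sets.sets_into_space by (fastforce simp: space_PiM)
    then show "emeasure (IT.CI {0..<n}) X = emeasure (IT.C 0 n (\<lambda>_. undefined)) X"
      by (simp only: IT.emeasure_CI[OF subset_refl X] prod_emb_id)
  qed
  \<comment> \<open>\<open>f\<close> varies in the induction because integrating out the last stage
    leaves a new function of the shorter history.\<close>
  have C: "(\<integral>\<^sup>+\<omega>. f (map \<omega> [0..<n]) \<partial>IT.C 0 n (\<lambda>_. undefined)) =
      (\<integral>\<^sup>+h. f h \<partial>history_law q k \<sigma> \<tau> n)" for n f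
  proof (induction n arbitrary: f)
    case 0
    show ?case
      by (subst IT.C.simps, subst nn_integral_return) (simp_all add: space_PiM)
  next
    case (Suc n)
    have "(\<integral>\<^sup>+\<omega>. f (map \<omega> [0..<Suc n]) \<partial>IT.C 0 (Suc n) (\<lambda>_. undefined)) =
        (\<integral>\<^sup>+\<omega>. \<integral>\<^sup>+\<omega>'. f (map \<omega>' [0..<Suc n]) \<partial>IT.eP n \<omega> \<partial>IT.C 0 n (\<lambda>_. undefined))"
      unfolding IT.C.simps
      using IT.measurable_eP[of n] meas[of f "Suc n"]
      by (subst nn_integral_bind[where B = "?M (Suc n)"])
        (simp_all add: measurable_cong_sets[OF IT.sets_C])
    also have "\<dots> = (\<integral>\<^sup>+\<omega>. \<integral>\<^sup>+x. f (map \<omega> [0..<n] @ [x]) \<partial>stage_law q k \<sigma> \<tau> (map \<omega> [0..<n])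
        \<partial>IT.C 0 n (\<lambda>_. undefined))"
    proof (rule nn_integral_cong)
      fix \<omega> assume "\<omega> \<in> space (IT.C 0 n (\<lambda>_. undefined))"
      then have "\<omega> \<in> space (?M n)"
        by (simp add: IT.space_C)
      then show "(\<integral>\<^sup>+\<omega>'. f (map \<omega>' [0..<Suc n]) \<partial>IT.eP n \<omega>) =
          (\<integral>\<^sup>+x. f (map \<omega> [0..<n] @ [x]) \<partial>stage_law q k \<sigma> \<tau> (map \<omega> [0..<n]))"
        using meas[of f "Suc n"] by (subst IT.nn_integral_eP) (simp_all add: stage_kernel_def)
    qed
    also have "\<dots> = (\<integral>\<^sup>+h. f h \<partial>history_law q k \<sigma> \<tau> (Suc n))"
      by (simp add: Suc.IH[of "\<lambda>h. \<integral>\<^sup>+x. f (h @ [x]) \<partial>stage_law q k \<sigma> \<tau> h"])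
    finally show ?case .
  qed
  have restr: "(\<lambda>\<omega>. restrict \<omega> {0..<m}) \<in> play_measure q k \<sigma> \<tau> \<rightarrow>\<^sub>M ?M m"
    by (subst measurable_cong_sets[OF sets_play_measure refl]) (rule measurable_restrict_subset, simp)
  have "(\<integral>\<^sup>+\<omega>. f (map \<omega> [0..<m]) \<partial>play_measure q k \<sigma> \<tau>) =
      (\<integral>\<^sup>+\<omega>. f (map (restrict \<omega> {0..<m}) [0..<m]) \<partial>play_measure q k \<sigma> \<tau>)"
    by (intro nn_integral_cong arg_cong[of _ _ f]) simp
  also have "\<dots> = (\<integral>\<^sup>+\<omega>. f (map \<omega> [0..<m]) \<partial>distr (play_measure q k \<sigma> \<tau>) (?M m) (\<lambda>\<omega>. restrict \<omega> {0..<m}))"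
    using meas by (subst nn_integral_distr[OF restr]) simp_all
  also have "\<dots> = (\<integral>\<^sup>+h. f h \<partial>history_law q k \<sigma> \<tau> m)"
    by (simp only: distr_play_measure finite_atLeastLessThan CI C)
  finally show ?thesis .
qed

lemma measurable_play_history:
  "(\<lambda>\<omega>. map \<omega> [0..<m]) \<in> play_measure q k \<sigma> \<tau> \<rightarrow>\<^sub>M count_space
     (UNIV :: ('k::finite \<times> 'i::finite \<times> 'j::finite) list set)"
proof -
  have "(\<lambda>\<omega>. restrict \<omega> {0..<m}) \<in> play_measure q k \<sigma> \<tau> \<rightarrow>\<^sub>M PiM {0..<m} (\<lambda>_. count_space UNIV)"
    by (subst measurable_cong_sets[OF sets_play_measure refl]) (rule measurable_restrict_subset, simp)
  from measurable_compose[OF this measurable_history]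
  have "(\<lambda>\<omega>. map (restrict \<omega> {0..<m}) [0..<m]) \<in> play_measure q k \<sigma> \<tau> \<rightarrow>\<^sub>M count_space UNIV" .
  moreover have "map (restrict \<omega> {0..<m}) [0..<m] = map \<omega> [0..<m]" for \<omega> :: "nat \<Rightarrow> 'k \<times> 'i \<times> 'j"
    by simp
  ultimately show ?thesis
    by (simp only:)
qed

lemma distr_play_history:
  fixes q :: "'k::finite \<Rightarrow> 'i::finite \<Rightarrow> 'j::finite \<Rightarrow> 'k pmf"
  shows "distr (play_measure q k \<sigma> \<tau>) (count_space UNIV) (\<lambda>\<omega>. map \<omega> [0..<m]) =
    measure_pmf (history_law q k \<sigma> \<tau> m)"
proof (rule measure_eqI)
  fix X
  show "emeasure (distr (play_measure q k \<sigma> \<tau>) (count_space UNIV) (\<lambda>\<omega>. map \<omega> [0..<m])) X =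
      emeasure (history_law q k \<sigma> \<tau> m) X"
    using nn_integral_history[where f = "indicator X" and m = m and q = q and k = k and \<sigma> = \<sigma> and \<tau> = \<tau>]
    by (simp add: nn_integral_distr[OF measurable_play_history, symmetric]
      del: nn_integral_indicator flip: nn_integral_indicator)
qed simp

section \<open>Expectations of single stages\<close>

definition stage_expectation ::
  "('k::finite \<Rightarrow> 'i::finite \<Rightarrow> 'j::finite \<Rightarrow> 'k pmf) \<Rightarrow> 'k \<Rightarrow> ('k, 'i, 'j, 'i) strategy
    \<Rightarrow> ('k, 'i, 'j, 'j) strategy \<Rightarrow> nat \<Rightarrow> ('k \<Rightarrow> 'i \<Rightarrow> 'j \<Rightarrow> real) \<Rightarrow> real" where
  "stage_expectation q k \<sigma> \<tau> m f = (\<integral>\<omega>. (case \<omega> m of (l, a, b) \<Rightarrow> f l a b) \<partial>play_measure q k \<sigma> \<tau>)"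

lemma expectation_history_law_Suc:
  fixes q :: "'k::finite \<Rightarrow> 'i::finite \<Rightarrow> 'j::finite \<Rightarrow> 'k pmf" and f :: "_ \<Rightarrow> real"
  shows "measure_pmf.expectation (history_law q k \<sigma> \<tau> (Suc m)) f =
    measure_pmf.expectation (history_law q k \<sigma> \<tau> m)
      (\<lambda>h. measure_pmf.expectation (stage_law q k \<sigma> \<tau> h) (\<lambda>x. f (h @ [x])))"
  unfolding history_law.simps
  by (subst pmf_expectation_bind[OF finite_set_history_law _ order_refl], simp,
      subst integral_measure_pmf[OF finite_set_history_law]) auto

lemma expectation_stage_law:
  fixes q :: "'k::finite \<Rightarrow> 'i::finite \<Rightarrow> 'j::finite \<Rightarrow> 'k pmf" and f :: "_ \<Rightarrow> real"
  shows "measure_pmf.expectation (stage_law q k \<sigma> \<tau> h) f =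
    (\<Sum>l\<in>UNIV. pmf (state_law q k h) l *
      (\<Sum>a\<in>UNIV. \<Sum>b\<in>UNIV. pmf (\<sigma> h l) a * pmf (\<tau> h l) b * f (l, a, b)))"
proof -
  have "measure_pmf.expectation (pair_pmf p r) e =
      (\<Sum>a\<in>UNIV. \<Sum>b\<in>UNIV. pmf p a * pmf r b * e (a, b))" for p :: "'i pmf" and r :: "'j pmf" and e :: "_ \<Rightarrow> real"
    by (subst integral_measure_pmf_real[of UNIV])
      (auto simp: pmf_pair sum.cartesian_product mult_ac simp flip: UNIV_Times_UNIV intro!: sum.cong)
  then show ?thesis
    unfolding stage_law_def by (subst pmf_expectation_bind[of UNIV]) auto
qed

lemma stage_expectation_eq:
  "stage_expectation q k \<sigma> \<tau> m f =
    measure_pmf.expectation (history_law q k \<sigma> \<tau> m)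
      (\<lambda>h. measure_pmf.expectation (stage_law q k \<sigma> \<tau> h) (\<lambda>(l, a, b). f l a b))"
proof -
  \<comment> \<open>Stages being numbered from 0, the triple of stage \<open>m\<close> is the last
    entry of the history of length \<open>Suc m\<close>.\<close>
  have "stage_expectation q k \<sigma> \<tau> m f =
      (\<integral>h. (case last h of (l, a, b) \<Rightarrow> f l a b)
        \<partial>distr (play_measure q k \<sigma> \<tau>) (count_space UNIV) (\<lambda>\<omega>. map \<omega> [0..<Suc m]))"
    unfolding stage_expectation_def by (subst integral_distr[OF measurable_play_history]) simp_all
  then show ?thesis
    unfolding distr_play_history expectation_history_law_Suc by simp
qed

lemma state_law_Nil [simp]: "state_law q k [] = return_pmf k"
  by (simp add: state_law_def)

lemma state_law_snoc [simp]: "state_law q k (h @ [(l, a, b)]) = q l a b"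
  by (simp add: state_law_def)

lemma expectation_stage_law_state:
  fixes q :: "'k::finite \<Rightarrow> 'i::finite \<Rightarrow> 'j::finite \<Rightarrow> 'k pmf" and w :: "'k \<Rightarrow> real"
  shows "measure_pmf.expectation (stage_law q k \<sigma> \<tau> h) (\<lambda>(l, a, b). w l) =
    (\<Sum>l\<in>UNIV. pmf (state_law q k h) l * w l)"
  by (simp add: expectation_stage_law sum_distrib_left[symmetric] sum_distrib_right[symmetric] sum_pmf_eq_1)

lemma stage_expectation_state_0:
  "stage_expectation q k \<sigma> \<tau> 0 (\<lambda>l a b. w l) = w k"
  by (simp add: stage_expectation_eq expectation_stage_law_state pmf_return indicator_def
    if_distrib[of "\<lambda>x. x * _"] cong: if_cong)

text \<open>After a history ending in \<open>(l, a, b)\<close> the next state has law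
  \<open>q l a b\<close>. This moves a continuation value back by one stage and drives the
  telescoping of the payoff.\<close>

lemma stage_expectation_state_Suc:
  "stage_expectation q k \<sigma> \<tau> (Suc m) (\<lambda>l a b. w l) =
    stage_expectation q k \<sigma> \<tau> m (\<lambda>l a b. \<Sum>l'\<in>UNIV. pmf (q l a b) l' * w l')"
  unfolding stage_expectation_eq expectation_stage_law_state expectation_history_law_Suc
  by (intro Bochner_Integration.integral_cong refl) (auto simp: split_beta)

lemma integrable_stage:
  fixes q :: "'k::finite \<Rightarrow> 'i::finite \<Rightarrow> 'j::finite \<Rightarrow> 'k pmf" and f :: "'k \<Rightarrow> 'i \<Rightarrow> 'j \<Rightarrow> real"
  shows "integrable (play_measure q k \<sigma> \<tau>) (\<lambda>\<omega>. case \<omega> m of (l, a, b) \<Rightarrow> f l a b)"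
proof -
  interpret prob_space "play_measure q k \<sigma> \<tau>"
    by (rule prob_space_play_measure)
  have "(\<lambda>\<omega>. \<omega> m) \<in> play_measure q k \<sigma> \<tau> \<rightarrow>\<^sub>M count_space UNIV"
    by measurable
  from measurable_compose[OF this, of "\<lambda>(l, a, b). f l a b" borel] show ?thesis
    by (intro integrable_const_bound[where B = "MAX (l, a, b)\<in>UNIV. \<bar>f l a b\<bar>"])
      (simp_all add: split_beta abs_le_Max_UNIV)
qed

text \<open>The hypothesis concerns the conditional expectation given history and current state,
  where the two actions are independent. A stationary strategy can secure it against any
  history-dependent opponent.\<close>

lemma stage_expectation_ge_0:
  assumes "\<And>h l. 0 \<le> (\<Sum>a\<in>UNIV. \<Sum>b\<in>UNIV. pmf (\<sigma> h l) a * pmf (\<tau> h l) b * f l a b)"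
  shows "0 \<le> stage_expectation q k \<sigma> \<tau> m f"
  unfolding stage_expectation_eq expectation_stage_law prod.case
  by (rule Bochner_Integration.integral_nonneg, rule sum_nonneg, rule mult_nonneg_nonneg)
    (rule pmf_nonneg, rule assms)

lemma stage_expectation_minus:
  "stage_expectation q k \<sigma> \<tau> m (\<lambda>l a b. - f l a b) = - stage_expectation q k \<sigma> \<tau> m f"
  by (simp add: stage_expectation_def split_beta)

section \<open>Payoffs as series over stages\<close>

text \<open>Rewards are bounded, so a geometric series dominates and the sum over stages can be
  exchanged with the integral.\<close>

lemma payoff_sums:
  fixes g :: "'k::finite \<Rightarrow> 'i::finite \<Rightarrow> 'j::finite \<Rightarrow> real"
  assumes lam: "0 < lam" "lam \<le> 1"
  shows "(\<lambda>m. lam * (1 - lam) ^ m * stage_expectation q k \<sigma> \<tau> m g) sums payoff g q lam k \<sigma> \<tau>"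
proof -
  interpret prob_space "play_measure q k \<sigma> \<tau>"
    by (rule prob_space_play_measure)
  let ?f = "\<lambda>m \<omega>. lam * (1 - lam) ^ m * (case \<omega> m of (l, a, b) \<Rightarrow> g l a b)"
  define G where "G = (MAX (l, a, b)\<in>UNIV. \<bar>g l a b\<bar>)"
  have G: "\<bar>case x of (l, a, b) \<Rightarrow> g l a b\<bar> \<le> G" for x
    by (simp add: G_def split_beta abs_le_Max_UNIV)
  have le: "norm (?f m \<omega>) \<le> lam * G * (1 - lam) ^ m" for m \<omega>
    using lam mult_left_mono[OF G[of "\<omega> m"], of "lam * (1 - lam) ^ m"]
    by (simp add: abs_mult mult_ac)
  have summable: "summable (\<lambda>m. lam * G * (1 - lam) ^ m)"
    using lam by (intro summable_mult summable_geometric) auto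
  have int: "integrable (play_measure q k \<sigma> \<tau>) (?f m)" for m
    by (intro integrable_mult_right integrable_stage)
  have "(\<lambda>m. \<integral>\<omega>. ?f m \<omega> \<partial>play_measure q k \<sigma> \<tau>) sums (\<integral>\<omega>. (\<Sum>m. ?f m \<omega>) \<partial>play_measure q k \<sigma> \<tau>)"
  proof (rule sums_integral[OF int])
    show "AE \<omega> in play_measure q k \<sigma> \<tau>. summable (\<lambda>m. norm (?f m \<omega>))"
      by (intro AE_I2 summable_comparison_test'[OF summable, of 0]) (use le in auto)
    have "(\<integral>\<omega>. norm (?f m \<omega>) \<partial>play_measure q k \<sigma> \<tau>) \<le> lam * G * (1 - lam) ^ m" for m
      using le by (intro integral_le_const integrable_norm int AE_I2)
    then show "summable (\<lambda>m. \<integral>\<omega>. norm (?f m \<omega>) \<partial>play_measure q k \<sigma> \<tau>)"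
      by (intro summable_comparison_test'[OF summable, of 0]) simp
  qed
  then show ?thesis
    by (simp add: payoff_def discounted_reward_def[abs_def] stage_expectation_def)
qed

text \<open>
  The discounted continuation values \<open>(1 - \<lambda>)\<^sup>m E[w(k\<^sub>m)]\<close> telescope, so the payoff differs
  from \<open>w k\<close> by the discounted sum of the expected one-shot deviations from \<open>w\<close>.
\<close>

lemma payoff_deviation_sums:
  fixes g :: "'k::finite \<Rightarrow> 'i::finite \<Rightarrow> 'j::finite \<Rightarrow> real"
  assumes lam: "0 < lam" "lam \<le> 1"
  shows "(\<lambda>m. (1 - lam) ^ m *
      stage_expectation q k \<sigma> \<tau> m (\<lambda>l a b. shapley_entry g q lam w l a b - w l))
    sums (payoff g q lam k \<sigma> \<tau> - w k)"
proof -
  let ?E = "stage_expectation q k \<sigma> \<tau>"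
  define W where "W m = ?E m (\<lambda>l a b. w l)" for m
  interpret prob_space "play_measure q k \<sigma> \<tau>"
    by (rule prob_space_play_measure)
  \<comment> \<open>After multiplication by \<open>(1 - lam) ^ m\<close>, the two \<open>W\<close>
    terms are consecutive terms of a telescoping sequence.\<close>
  have dev: "?E m (\<lambda>l a b. shapley_entry g q lam w l a b - w l) = lam * ?E m g + (1 - lam) * W (Suc m) - W m" for m
  proof -
    let ?G = "\<lambda>\<omega>. case \<omega> m of (l, a, b) \<Rightarrow> g l a b" and ?W = "\<lambda>\<omega>. case \<omega> m of (l, a, b) \<Rightarrow> w l"
      and ?W' = "\<lambda>\<omega>. case \<omega> m of (l, a, b) \<Rightarrow> \<Sum>l'\<in>UNIV. pmf (q l a b) l' * w l'"
    have "?E m (\<lambda>l a b. shapley_entry g q lam w l a b - w l) =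
        (\<integral>\<omega>. lam * ?G \<omega> + (1 - lam) * ?W' \<omega> - ?W \<omega> \<partial>play_measure q k \<sigma> \<tau>)"
      unfolding stage_expectation_def shapley_entry_def
      by (intro Bochner_Integration.integral_cong refl) (simp split: prod.split)
    also have "\<dots> = lam * (\<integral>\<omega>. ?G \<omega> \<partial>play_measure q k \<sigma> \<tau>) +
        (1 - lam) * (\<integral>\<omega>. ?W' \<omega> \<partial>play_measure q k \<sigma> \<tau>) - (\<integral>\<omega>. ?W \<omega> \<partial>play_measure q k \<sigma> \<tau>)"
      by (simp only: Bochner_Integration.integral_diff Bochner_Integration.integral_add integral_mult_right_zero
        Bochner_Integration.integrable_add integrable_mult_right integrable_stage)
    finally show ?thesis
      unfolding W_def stage_expectation_state_Suc by (simp only: stage_expectation_def)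
  qed
  \<comment> \<open>A bound on \<open>W\<close> makes \<open>(1 - lam) ^ m * W m\<close> tend to 0,
    so only the initial term of the telescoping sum survives.\<close>
  define B where "B = (MAX l. \<bar>w l\<bar>)"
  have B: "\<bar>w l\<bar> \<le> B" for l
    unfolding B_def by (intro Max_ge) auto
  have "\<bar>W m\<bar> \<le> B" for m
  proof -
    have "\<bar>W m\<bar> \<le> (\<integral>\<omega>. \<bar>case \<omega> m of (l, a, b) \<Rightarrow> w l\<bar> \<partial>play_measure q k \<sigma> \<tau>)"
      unfolding W_def stage_expectation_def by (rule integral_abs_bound)
    also have "\<dots> \<le> B"
      by (rule integral_le_const[OF integrable_abs[OF integrable_stage]], rule AE_I2)
        (simp split: prod.split add: B)
    finally show ?thesis .
  qed
  then have le: "norm ((1 - lam) ^ m * W m) \<le> (1 - lam) ^ m * B" for m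
    using lam by (simp add: abs_mult mult_left_mono)
  have lim: "(\<lambda>m. (1 - lam) ^ m * B) \<longlonglongrightarrow> 0"
    using lam by (intro tendsto_mult_left_zero LIMSEQ_realpow_zero) auto
  have "(\<lambda>m. (1 - lam) ^ m * W m) \<longlonglongrightarrow> 0"
    by (rule Lim_null_comparison[OF always_eventually lim]) (rule allI, rule le)
  then have "(\<lambda>m. (1 - lam) ^ Suc m * W (Suc m) - (1 - lam) ^ m * W m) sums (0 - (1 - lam) ^ 0 * W 0)"
    by (rule telescope_sums)
  from sums_add[OF payoff_sums[OF lam, of q k \<sigma> \<tau> g] this]
  show ?thesis
    by (simp add: dev W_def[of 0] stage_expectation_state_0 algebra_simps)
qed

text \<open>Given history and state, the expected deviation is an average, over the opponent's
  actions, of excesses that \<open>x\<close> makes nonnegative. So every term of the deviation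
  series is nonnegative.\<close>

lemma payoff_ge:
  fixes g :: "'k::finite \<Rightarrow> 'i::finite \<Rightarrow> 'j::finite \<Rightarrow> real"
  assumes lam: "0 < lam" "lam \<le> 1"
    and x: "\<And>l b. w l \<le> (\<Sum>a\<in>UNIV. pmf (x l) a * shapley_entry g q lam w l a b)"
  shows "w k \<le> payoff g q lam k (\<lambda>_. x) \<tau>"
proof -
  have "0 \<le> stage_expectation q k (\<lambda>_. x) \<tau> m (\<lambda>l a b. shapley_entry g q lam w l a b - w l)" for m
  proof (rule stage_expectation_ge_0)
    fix h l
    have "(\<Sum>a\<in>UNIV. \<Sum>b\<in>UNIV. pmf (x l) a * pmf (\<tau> h l) b * (shapley_entry g q lam w l a b - w l)) =
        (\<Sum>b\<in>UNIV. pmf (\<tau> h l) b * ((\<Sum>a\<in>UNIV. pmf (x l) a * shapley_entry g q lam w l a b) - (\<Sum>a\<in>UNIV. pmf (x l) a) * w l))"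
      by (subst sum.swap) (simp add: sum_distrib_left sum_distrib_right right_diff_distrib sum_subtractf mult_ac)
    then show "0 \<le> (\<Sum>a\<in>UNIV. \<Sum>b\<in>UNIV. pmf (x l) a * pmf (\<tau> h l) b * (shapley_entry g q lam w l a b - w l))"
      using x by (simp add: sum_pmf_eq_1 sum_nonneg)
  qed
  then have "0 \<le> payoff g q lam k (\<lambda>_. x) \<tau> - w k"
    using lam by (intro sums_le[OF _ sums_zero payoff_deviation_sums[OF lam]]) simp
  then show ?thesis
    by simp
qed

lemma payoff_le:
  fixes g :: "'k::finite \<Rightarrow> 'i::finite \<Rightarrow> 'j::finite \<Rightarrow> real"
  assumes lam: "0 < lam" "lam \<le> 1"
    and y: "\<And>l a. (\<Sum>b\<in>UNIV. pmf (y l) b * shapley_entry g q lam w l a b) \<le> w l"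
  shows "payoff g q lam k \<sigma> (\<lambda>_. y) \<le> w k"
proof -
  \<comment> \<open>The sign lemma gives lower bounds, hence the negated deviation.\<close>
  have "0 \<le> stage_expectation q k \<sigma> (\<lambda>_. y) m (\<lambda>l a b. - (shapley_entry g q lam w l a b - w l))" for m
  proof (rule stage_expectation_ge_0)
    fix h l
    have "(\<Sum>a\<in>UNIV. \<Sum>b\<in>UNIV. pmf (\<sigma> h l) a * pmf (y l) b * (- (shapley_entry g q lam w l a b - w l))) =
        (\<Sum>a\<in>UNIV. pmf (\<sigma> h l) a * ((\<Sum>b\<in>UNIV. pmf (y l) b) * w l - (\<Sum>b\<in>UNIV. pmf (y l) b * shapley_entry g q lam w l a b)))"
      by (simp add: sum_distrib_left sum_distrib_right right_diff_distrib sum_subtractf mult_ac)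
    then show "0 \<le> (\<Sum>a\<in>UNIV. \<Sum>b\<in>UNIV. pmf (\<sigma> h l) a * pmf (y l) b * (- (shapley_entry g q lam w l a b - w l)))"
      using y by (simp add: sum_pmf_eq_1 sum_nonneg)
  qed
  then have "stage_expectation q k \<sigma> (\<lambda>_. y) m (\<lambda>l a b. shapley_entry g q lam w l a b - w l) \<le> 0" for m
    unfolding stage_expectation_minus by simp
  then have "payoff g q lam k \<sigma> (\<lambda>_. y) - w k \<le> 0"
    using lam by (intro sums_le[OF _ payoff_deviation_sums[OF lam] sums_zero]) (simp add: mult_nonneg_nonpos)
  then show ?thesis
    by simp
qed

subsection \<open>The value of the discounted game\<close>

lemma payoff_bound:
  fixes g :: "'k::finite \<Rightarrow> 'i::finite \<Rightarrow> 'j::finite \<Rightarrow> real"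
  assumes lam: "0 < lam" "lam \<le> 1"
  shows "\<bar>payoff g q lam k \<sigma> \<tau>\<bar> \<le> (MAX (l, a, b)\<in>UNIV. \<bar>g l a b\<bar>)"
proof -
  interpret prob_space "play_measure q k \<sigma> \<tau>"
    by (rule prob_space_play_measure)
  have "\<bar>payoff g q lam k \<sigma> \<tau>\<bar> \<le> (\<integral>\<omega>. \<bar>discounted_reward g lam \<omega>\<bar> \<partial>play_measure q k \<sigma> \<tau>)"
    unfolding payoff_def by (rule integral_abs_bound)
  also have "\<dots> \<le> (MAX (l, a, b)\<in>UNIV. \<bar>g l a b\<bar>)"
    by (rule integral_le_const[OF integrable_abs[OF integrable_discounted_reward[OF lam]]], rule AE_I2)
      (rule discounted_reward_bound[OF lam])
  finally show ?thesis .
qed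

text \<open>Against every history-dependent opponent, \<open>x\<close> guarantees Player 1 at least
  \<open>w k\<close>, and \<open>y\<close> holds Player 1 to at most \<open>w k\<close>.\<close>

lemma discounted_val_eqI:
  fixes g :: "'k::finite \<Rightarrow> 'i::finite \<Rightarrow> 'j::finite \<Rightarrow> real"
  assumes lam: "0 < lam" "lam \<le> 1"
    and x: "\<And>l b. w l \<le> (\<Sum>a\<in>UNIV. pmf (x l) a * shapley_entry g q lam w l a b)"
    and y: "\<And>l a. (\<Sum>b\<in>UNIV. pmf (y l) b * shapley_entry g q lam w l a b) \<le> w l"
  shows "discounted_val g q lam k = w k"
  unfolding discounted_val_def
proof (rule antisym)
  show "(SUP \<sigma>. INF \<tau>. payoff g q lam k \<sigma> \<tau>) \<le> w k"
    by (rule SUP_INF_le, rule payoff_bound[OF lam], rule payoff_le[OF lam y])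
  show "w k \<le> (SUP \<sigma>. INF \<tau>. payoff g q lam k \<sigma> \<tau>)"
    by (rule SUP_INF_ge, rule payoff_bound[OF lam], rule payoff_ge[OF lam x])
qed

section \<open>The determinantal equation\<close>

lemma d0_pos:
  assumes "0 < lam" "lam \<le> 1"
  shows "0 < d0 q lam ii jj"
  unfolding d0_def using assms
  by (intro discounted_kernel_det_pos) (auto simp: trans_matrix_def sum_pmf_eq_1)

theorem theorem1:
  fixes g :: "'k::finite \<Rightarrow> 'i::finite \<Rightarrow> 'j::finite \<Rightarrow> real"
    and q :: "'k \<Rightarrow> 'i \<Rightarrow> 'j \<Rightarrow> 'k pmf"
    and k :: 'k and lam :: real
  assumes "0 < lam" and "lam \<le> 1"
  shows "matrix_val (W_matrix g q lam k (discounted_val g q lam k)) = 0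
    \<and> (\<forall>z::real. matrix_val (W_matrix g q lam k z) = 0 \<longrightarrow> z = discounted_val g q lam k)"
proof -
  obtain x :: "'k \<Rightarrow> 'i pmf" and y :: "'k \<Rightarrow> 'j pmf" and w :: "'k \<Rightarrow> real"
    where x: "\<And>l b. w l \<le> (\<Sum>a\<in>UNIV. pmf (x l) a * shapley_entry g q lam w l a b)"
      and y: "\<And>l a. (\<Sum>b\<in>UNIV. pmf (y l) b * shapley_entry g q lam w l a b) \<le> w l"
    by (rule stationary_equilibrium[OF assms, where g = g and q = q]) (rule that)
  have val: "discounted_val g q lam k = w k"
    by (rule discounted_val_eqI[OF assms x y])
  \<comment> \<open>Finitely many pure stationary profiles give a positive minimum of
    \<open>d0\<close>, a uniform bound for the slope of the entries in \<open>z\<close>.\<close>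
  define c where "c = Min (range (\<lambda>(ii, jj). d0 q lam ii jj))"
  have "c \<in> range (\<lambda>(ii, jj). d0 q lam ii jj)"
    unfolding c_def by (intro Min_in) auto
  then have "0 < c"
    using d0_pos[OF assms] by auto
  have "c \<le> (case p of (ii, jj) \<Rightarrow> d0 q lam ii jj)" for p
    unfolding c_def by (intro Min_le) auto
  from this[of "(_, _)"] have c: "c \<le> d0 q lam ii jj" for ii jj
    by simp
  \<comment> \<open>Entries are affine in \<open>z\<close>; the part at \<open>z = w k\<close> is
    split off because its averages have a known sign.\<close>
  have shift: "dk g q lam k ii jj - z * d0 q lam ii jj =
      (dk g q lam k ii jj - w k * d0 q lam ii jj) + (w k - z) * d0 q lam ii jj" for ii jj z
    by (simp add: algebra_simps)
  \<comment> \<open>Player 1 mixes pure stationary strategies by drawing the actions of the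
    different states independently from \<open>x\<close>.\<close>
  have lower: "(w k - z) * c \<le> matrix_val (W_matrix g q lam k z)" if "z \<le> w k" for z
  proof (rule matrix_val_ge)
    fix jj
    let ?p = "Pi_pmf UNIV undefined x"
    have "0 \<le> (\<Sum>ii\<in>UNIV. pmf ?p ii * (dk g q lam k ii jj - w k * d0 q lam ii jj))"
      using mixed_determinants_sign(1)[OF assms, of x "\<lambda>l a. g l a (jj l)" "\<lambda>l a. q l a (jj l)" w undefined k]
        x[unfolded shapley_entry_def]
      by (simp add: dk_def d0_def trans_matrix_def reward_vec_def cong: if_cong)
    moreover have "(w k - z) * c \<le> (\<Sum>ii\<in>UNIV. pmf ?p ii * ((w k - z) * d0 q lam ii jj))"
      using that by (intro pmf_average_ge mult_left_mono c) simp
    ultimately show "(w k - z) * c \<le> (\<Sum>ii\<in>UNIV. pmf ?p ii * W_matrix g q lam k z $ ii $ jj)"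
      by (simp add: W_matrix_def shift[of _ _ z] distrib_left sum.distrib)
  qed
  \<comment> \<open>Player 2 does the same with \<open>y\<close>. Here \<open>w k - z\<close> is
    nonpositive, so the lower bound \<open>c\<close> on \<open>d0\<close> yields an upper
    bound.\<close>
  have upper: "matrix_val (W_matrix g q lam k z) \<le> (w k - z) * c" if "w k \<le> z" for z
  proof (rule matrix_val_le)
    fix ii
    let ?p = "Pi_pmf UNIV undefined y"
    have "(\<Sum>jj\<in>UNIV. pmf ?p jj * (dk g q lam k ii jj - w k * d0 q lam ii jj)) \<le> 0"
      using mixed_determinants_sign(2)[OF assms, of y "\<lambda>l b. g l (ii l) b" "\<lambda>l b. q l (ii l) b" w undefined k]
        y[unfolded shapley_entry_def]
      by (simp add: dk_def d0_def trans_matrix_def reward_vec_def cong: if_cong)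
    moreover have "(\<Sum>jj\<in>UNIV. pmf ?p jj * ((w k - z) * d0 q lam ii jj)) \<le> (w k - z) * c"
      using that by (intro pmf_average_le mult_left_mono_neg c) simp
    ultimately show "(\<Sum>jj\<in>UNIV. pmf ?p jj * W_matrix g q lam k z $ ii $ jj) \<le> (w k - z) * c"
      by (simp add: W_matrix_def shift[of _ _ z] distrib_left sum.distrib)
  qed
  \<comment> \<open>For \<open>z\<close> below \<open>w k\<close> the value is positive, for
    \<open>z\<close> above it is negative.\<close>
  have "z = w k" if "matrix_val (W_matrix g q lam k z) = 0" for z
    using lower[of z] upper[of z] \<open>0 < c\<close> that
    by (cases z "w k" rule: linorder_cases) (auto simp: mult_le_0_iff zero_le_mult_iff)
  moreover have "matrix_val (W_matrix g q lam k (w k)) = 0"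
    using lower[of "w k"] upper[of "w k"] by simp
  ultimately show ?thesis
    unfolding val by blast
qed

end
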